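(* For every $\gamma\in\mathcal{C}(\mathbb{D}_3)$, the number of steps in the untwisting algorithm (described in the context) started at $\gamma$ is equal to the minimal graph-distance in $\Gamma_{\mathcal{C}}$ from $\gamma$ to the set $\Lambda=\{c,d,e\}$.
   Context: $\mathbb{D}_3$ is a closed round disc in the plane with three marked interior points $p_1,p_2,p_3$, in this order from left to right on the horizontal diameter. $\mathrm{PMod}(\mathbb{D}_3)$ is the group of isotopy classes of orientation-preserving self-homeomorphisms of the disc preserving the boundary set-wise and fixing each marked point. An essential curve is a simple closed curve in the complement of the marked points bounding a disc with exactly two marked points; $\mathcal{C}(\mathbb{D}_3)$ is the set of isotopy classes of essential curves. Dynnikov coordinates: let $\alpha_1$ (resp. $\alpha_2$) be the vertical arc from $p_2$ up (resp. down) to the boundary, $\beta_1$ a vertical arc with both ends on the boundary passing between $p_1$ and $p_2$, and $\beta_2$ a similar arc between $p_2$ and $p_3$. With $\alpha_i(\gamma),\beta_i(\gamma)$ the geometric intersection numbers, the Dynnikov coordinates of $\gamma$ are $a=\frac{\alpha_2(\gamma)-\alpha_1(\gamma)}2$, $b=\frac{\beta_1(\gamma)-\beta_2(\gamma)}2$. They identify $\mathcal{C}(\mathbb{D}_3)$ with the set of primitive vectors in $\mathbb{Z}^2$. The curves $c,d,e$ are those with coordinates $(0,1),(0,-1),(-1,0)$; $\Lambda=\{c,d,e\}$. The Dehn twists $t_c,t_d$ freely generate $\mathrm{PMod}(\mathbb{D}_3)$; the handedness convention is such that in Dynnikov coordinates they act by $$t_c(a,b)=\begin{cases}(b-a,-b)&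 a\ge0,\ b\le a\\ (b-a,b-2a)& 0\le a\le b\le 2a\\ (a,b-2a)& 2a\le b,\ b\ge0\\ (a+b,-2a-b)& a\le0,\ b\le0\end{cases}\qquad t_d(a,b)=\begin{cases}(b-a,-b)& a\le0,\ a\le b\\ (b-a,b-2a)& 2a\le b\le a\le 0\\ (a,b-2a)& b\le 2a,\ b\le0\\ (a+b,-2a-b)& a\ge0,\ b\ge0.\end{cases}$$ Untwisting algorithm: start with $\gamma_0=\gamma$. If $\gamma_k\in\Lambda$, stop. Otherwise, let $(a_k,b_k)$ be the Dynnikov coordinates of $\gamma_k$ and set $\gamma_{k+1}=t(\gamma_k)$ (one step), where, if $a_k,b_k$ are both nonzero: $t=t_c$ if $a_k,b_k>0$; $t=t_c^{-1}$ if $a_k<0,b_k>0$; $t=t_d$ if $a_k,b_k<0$; $t=t_d^{-1}$ if $a_k>0,b_k<0$. If $a_kb_k=0$ and $\gamma_k\notin\Lambda$, then $(a_k,b_k)=(1,0)$ and one takes $t=t_c$ or $t=t_d^{-1}$ (either gives $(-1,0)$, i.e. $e$), choosing the same twist as on the previous step, or either one if $k=0$. Cayley graph $\Gamma_{\mathcal{C}}$: its vertex set is $\mathcal{C}(\mathbb{D}_3)$, and distinct vertices $v_1,v_2$ are connected by an edge if $v_2=g(v_1)$ or $v_1=g(v_2)$ for some $g\in\{t_c,t_d\}$ (no loop-edges). The graph-distance between two vertices of one connected component is the length of a minimal path; each vertex lies in the component of some element of $\Lambda$, and the distance to $\Lambda$ is the minimum over such elements. *)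

theory Defs
  imports "HOL-Analysis.Analysis" "HOL-Library.Extended_Nat"
begin

section \<open>Essential curves in the three-punctured disc\<close>

definition disc :: "complex set" where
  "disc = cball 0 1"

definition p1 :: complex where "p1 = - 1 / 2"
definition p2 :: complex where "p2 = 0"
definition p3 :: complex where "p3 = 1 / 2"

definition marked_points :: "complex set" where
  "marked_points = {p1, p2, p3}"

text \<open>Curves are unparametrised, i.e. they are sets of points.\<close>

definition essential_curve :: "complex set \<Rightarrow> bool" where
  "essential_curve \<gamma> \<longleftrightarrow>
     (\<exists>p. simple_path p \<and> pathfinish p = pathstart p \<and> path_image p = \<gamma>) \<and>
     \<gamma> \<subseteq> disc - marked_points \<and>
     (\<exists>\<Delta>. \<Delta> \<subseteq> disc \<and> \<Delta> homeomorphic (cball 0 1 :: complex set) \<and> frontier \<Delta> = \<gamma> \<and>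
          card (\<Delta> \<inter> marked_points) = 2)"

text \<open>Isotopy through simple closed curves avoiding the marked points.\<close>

definition isotopic_curves :: "complex set \<Rightarrow> complex set \<Rightarrow> bool" where
  "isotopic_curves \<gamma> \<delta> \<longleftrightarrow>
     (\<exists>p q. homotopic_with_canon (\<lambda>r. simple_path r \<and> pathfinish r = pathstart r)
              {0..1} (disc - marked_points) p q \<and>
            path_image p = \<gamma> \<and> path_image q = \<delta>)"

type_synonym curve_class = "complex set set"

definition curve_classes :: "curve_class set" where
  "curve_classes = {\<gamma>. essential_curve \<gamma>} //
     {(\<gamma>, \<delta>). essential_curve \<gamma> \<and> essential_curve \<delta> \<and> isotopic_curves \<gamma> \<delta>}"


section \<open>Dynnikov coordinates\<close>

definition arc_alpha1 :: "complex set" where "arc_alpha1 = closed_segment p2 \<i>"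
definition arc_alpha2 :: "complex set" where "arc_alpha2 = closed_segment p2 (- \<i>)"
definition arc_beta1 :: "complex set" where "arc_beta1 = {z \<in> disc. Re z = - 1 / 4}"
definition arc_beta2 :: "complex set" where "arc_beta2 = {z \<in> disc. Re z = 1 / 4}"

definition geometric_intersection :: "complex set \<Rightarrow> curve_class \<Rightarrow> nat" where
  "geometric_intersection A X = (LEAST n. \<exists>\<gamma>\<in>X. finite (\<gamma> \<inter> A) \<and> card (\<gamma> \<inter> A) = n)"

text \<open>
  Both differences are even: an essential curve meets each of the separating arcs
  \<open>\<alpha>\<^sub>1 \<union> \<alpha>\<^sub>2\<close>, \<open>\<beta>\<^sub>1\<close>, \<open>\<beta>\<^sub>2\<close> an even number of times.  So the integer division is exact.
\<close>

definition dynnikov :: "curve_class \<Rightarrow> int \<times> int" where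
  "dynnikov X =
     ((int (geometric_intersection arc_alpha2 X) - int (geometric_intersection arc_alpha1 X)) div 2,
      (int (geometric_intersection arc_beta1 X) - int (geometric_intersection arc_beta2 X)) div 2)"

definition primitive_vectors :: "(int \<times> int) set" where
  "primitive_vectors = {(a, b). coprime a b}"

definition curve_c :: curve_class where
  "curve_c = (THE X. X \<in> curve_classes \<and> dynnikov X = (0, 1))"

definition curve_d :: curve_class where
  "curve_d = (THE X. X \<in> curve_classes \<and> dynnikov X = (0, - 1))"

definition curve_e :: curve_class where
  "curve_e = (THE X. X \<in> curve_classes \<and> dynnikov X = (- 1, 0))"

definition Lambda :: "curve_class set" where
  "Lambda = {curve_c, curve_d, curve_e}"


section \<open>Dehn twists\<close>

text \<open>
  The Dehn twist about the circle with centre \<open>q\<close> and radius \<open>1/2\<close>, supported in the annulus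
  \<open>3/8 \<le> \<bar>z - q\<bar> \<le> 5/8\<close>.  The rotation angle decreases from \<open>2\<pi>\<close> at the inner boundary to \<open>0\<close>
  at the outer one, i.e. the inner disc makes a full counterclockwise turn.  For
  \<open>q = -1/4\<close> (resp. \<open>q = 1/4\<close>) the circle separates \<open>p1, p2\<close> (resp. \<open>p2, p3\<close>) from the third
  marked point, so it represents \<open>c\<close> (resp. \<open>d\<close>), and the annulus lies in the interior of the
  disc and avoids the marked points.
\<close>

definition dehn_twist :: "complex \<Rightarrow> complex \<Rightarrow> complex" where
  "dehn_twist q z =
     q + cis (2 * pi * max 0 (min 1 ((5 / 8 - cmod (z - q)) / (1 / 4)))) * (z - q)"

definition twist_homeo_c :: "complex \<Rightarrow> complex" where
  "twist_homeo_c = dehn_twist (- 1 / 4)"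

definition twist_homeo_d :: "complex \<Rightarrow> complex" where
  "twist_homeo_d = dehn_twist (1 / 4)"

datatype twist = Tc | Tc_inv | Td | Td_inv

fun twist_homeo :: "twist \<Rightarrow> complex \<Rightarrow> complex" where
  "twist_homeo Tc = twist_homeo_c"
| "twist_homeo Tc_inv = inv twist_homeo_c"
| "twist_homeo Td = twist_homeo_d"
| "twist_homeo Td_inv = inv twist_homeo_d"

text \<open>
  A homeomorphism preserving the disc and the marked points carries isotopy classes onto isotopy
  classes, so the elementwise image of a class is again a class.
\<close>

definition apply_twist :: "twist \<Rightarrow> curve_class \<Rightarrow> curve_class" where
  "apply_twist t X = (\<lambda>\<gamma>. twist_homeo t ` \<gamma>) ` X"

text \<open>
  The piecewise linear formulas for the action in Dynnikov coordinates.  The regions overlap only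
  where the formulas agree.
\<close>

fun dynnikov_tc :: "int \<times> int \<Rightarrow> int \<times> int" where
  "dynnikov_tc (a, b) =
     (if a \<ge> 0 \<and> b \<le> a then (b - a, - b)
      else if 0 \<le> a \<and> a \<le> b \<and> b \<le> 2 * a then (b - a, b - 2 * a)
      else if 2 * a \<le> b \<and> b \<ge> 0 then (a, b - 2 * a)
      else (a + b, - 2 * a - b))"

fun dynnikov_td :: "int \<times> int \<Rightarrow> int \<times> int" where
  "dynnikov_td (a, b) =
     (if a \<le> 0 \<and> a \<le> b then (b - a, - b)
      else if 2 * a \<le> b \<and> b \<le> a \<and> a \<le> 0 then (b - a, b - 2 * a)
      else if b \<le> 2 * a \<and> b \<le> 0 then (a, b - 2 * a)
      else (a + b, - 2 * a - b))"


section \<open>The untwisting algorithm\<close>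

text \<open>
  \<open>untwisting_choice prev X t\<close>: at a curve \<open>X \<notin> \<Lambda>\<close>, the algorithm may apply \<open>t\<close>, where \<open>prev\<close>
  is the twist applied on the previous step (\<open>None\<close> if this is the first step).
\<close>

definition untwisting_choice :: "twist option \<Rightarrow> curve_class \<Rightarrow> twist \<Rightarrow> bool" where
  "untwisting_choice prev X t \<longleftrightarrow>
     (let (a, b) = dynnikov X in
      if a > 0 \<and> b > 0 then t = Tc
      else if a < 0 \<and> b > 0 then t = Tc_inv
      else if a < 0 \<and> b < 0 then t = Td
      else if a > 0 \<and> b < 0 then t = Td_inv
      else t \<in> {Tc, Td_inv} \<and> (prev = None \<or> prev = Some t))"

text \<open>
  \<open>untwisting_takes prev X n\<close>: starting from \<open>X\<close>, every execution of the algorithm (whatever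
  the choices made) stops in \<open>\<Lambda>\<close> after exactly \<open>n\<close> steps, and none gets stuck.
\<close>

inductive untwisting_takes :: "twist option \<Rightarrow> curve_class \<Rightarrow> nat \<Rightarrow> bool" where
  stop: "X \<in> Lambda \<Longrightarrow> untwisting_takes prev X 0"
| step: "X \<notin> Lambda \<Longrightarrow> \<exists>t. untwisting_choice prev X t \<Longrightarrow>
         (\<And>t. untwisting_choice prev X t \<Longrightarrow> untwisting_takes (Some t) (apply_twist t X) n) \<Longrightarrow>
         untwisting_takes prev X (Suc n)"


section \<open>The Cayley graph\<close>

definition cayley_edges :: "(curve_class \<times> curve_class) set" where
  "cayley_edges =
     {(X, Y). X \<in> curve_classes \<and> Y \<in> curve_classes \<and> X \<noteq> Y \<and>
        (\<exists>g\<in>{Tc, Td}. Y = apply_twist g X \<or> X = apply_twist g Y)}"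

text \<open>Distances are \<open>\<infinity>\<close> between different components.\<close>

definition graph_distance :: "curve_class \<Rightarrow> curve_class \<Rightarrow> enat" where
  "graph_distance X Y = (INF n \<in> {n. (X, Y) \<in> cayley_edges ^^ n}. enat n)"

definition distance_to_Lambda :: "curve_class \<Rightarrow> enat" where
  "distance_to_Lambda X = (INF Y \<in> Lambda. graph_distance X Y)"

end

theory Submission
  imports Defs
begin

text \<open>
  Every edge of the Cayley graph is a step of the untwisting algorithm, in one direction or the
  other: if \<open>v \<noteq> t\<^sub>c v\<close>, then \<open>v\<close> lies in the open first quadrant, where the algorithm applies
  \<open>t\<^sub>c\<close>, or \<open>t\<^sub>c v\<close> lies in the open second quadrant, where it applies the inverse of \<open>t\<^sub>c\<close>, or
  \<open>v = (1, 0)\<close>; the situation for \<open>t\<^sub>d\<close> is symmetric.  Hence the step count changes by exactly one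
  along each edge, so it is at most the distance to \<open>\<Lambda>\<close>, and the run of the algorithm is a path
  realising it.  To stay inside the set of curve classes, this needs the topological fact that the
  twists are homeomorphisms permuting isotopy classes.
\<close>

section \<open>Homeomorphisms acting on curve classes\<close>

text \<open>The homeomorphism is of the whole plane because \<open>frontier\<close> in
  \<open>essential_curve\<close> and \<open>inv\<close> in \<open>twist_homeo\<close> both refer to
  the whole plane.\<close>

definition marked_disc_homeo :: "(complex \<Rightarrow> complex) \<Rightarrow> (complex \<Rightarrow> complex) \<Rightarrow> bool" where
  "marked_disc_homeo h k \<longleftrightarrow>
     homeomorphism UNIV UNIV h k \<and> h ` disc = disc \<and> (\<forall>p\<in>marked_points. h p = p)"

lemma marked_disc_homeo_sym:
  assumes "marked_disc_homeo h k"
  shows "marked_disc_homeo k h"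
proof -
  have hk: "homeomorphism UNIV UNIV h k" and d: "h ` disc = disc"
    and m: "\<forall>p\<in>marked_points. h p = p"
    using assms by (auto simp: marked_disc_homeo_def)
  have kh: "k (h x) = x" for x using hk by (simp add: homeomorphism_def)
  have "k ` disc = k ` h ` disc" using d by simp
  then have "k ` disc = disc" by (simp add: image_image kh)
  moreover have "k p = p" if "p \<in> marked_points" for p
    using m that kh[of p] by simp
  ultimately show ?thesis
    using homeomorphism_symD[OF hk] by (simp add: marked_disc_homeo_def)
qed

lemma homeomorphism_UNIV_inj:
  assumes "homeomorphism UNIV UNIV h k"
  shows "inj h"
  using homeomorphism_apply1[OF assms] by (metis UNIV_I injI)

lemma homeomorphism_UNIV_inv:
  assumes "homeomorphism UNIV UNIV h k"
  shows "inv h = k"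
  using homeomorphism_apply1[OF assms] homeomorphism_apply2[OF assms]
  by (intro inv_unique_comp) (simp_all add: fun_eq_iff)

lemma marked_disc_homeo_image_Diff:
  assumes "marked_disc_homeo h k"
  shows "h ` (disc - marked_points) = disc - marked_points"
proof -
  have "inj h" using assms homeomorphism_UNIV_inj by (auto simp: marked_disc_homeo_def)
  moreover have "h ` marked_points = marked_points"
    using assms by (auto simp: marked_disc_homeo_def)
  ultimately show ?thesis
    using assms by (simp add: image_set_diff marked_disc_homeo_def)
qed

lemma simple_path_homeomorphism_UNIV:
  assumes "homeomorphism UNIV UNIV h k" and "simple_path r"
  shows "simple_path (h \<circ> r)"
proof -
  have "inj h" using assms(1) by (rule homeomorphism_UNIV_inj)
  moreover have "path (h \<circ> r)"
    using assms(2) continuous_on_subset[OF homeomorphism_cont1[OF assms(1)]]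
    by (intro path_continuous_image simple_path_imp_path) auto
  ultimately show ?thesis
    using assms(2) by (auto simp: simple_path_def loop_free_def inj_eq)
qed

lemma frontier_homeomorphism_UNIV:
  fixes h k :: "'a::topological_space \<Rightarrow> 'a"
  assumes "homeomorphism UNIV UNIV h k"
  shows "frontier (h ` S) = h ` frontier S"
proof -
  have "homeomorphic_maps euclidean euclidean h k"
    using assms by (auto simp: homeomorphic_maps_def homeomorphism_def continuous_map_iff_continuous2)
  then have "homeomorphic_map euclidean euclidean h"
    using homeomorphic_map_maps by blast
  from homeomorphic_map_frontier_of[OF this, of S] show ?thesis by simp
qed

lemma essential_curve_image:
  assumes h: "marked_disc_homeo h k" and "essential_curve \<gamma>"
  shows "essential_curve (h ` \<gamma>)"
proof -
  have hom: "homeomorphism UNIV UNIV h k" and fix_mp: "\<forall>p\<in>marked_points. h p = p"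
    and hd: "h ` disc = disc"
    using h by (auto simp: marked_disc_homeo_def)
  have inj: "inj h" using hom by (rule homeomorphism_UNIV_inj)
  obtain p \<Delta> where p: "simple_path p" "pathfinish p = pathstart p" "path_image p = \<gamma>"
    and sub: "\<gamma> \<subseteq> disc - marked_points"
    and \<Delta>: "\<Delta> \<subseteq> disc" "\<Delta> homeomorphic (cball 0 1 :: complex set)" "frontier \<Delta> = \<gamma>"
      "card (\<Delta> \<inter> marked_points) = 2"
    using assms(2) by (auto simp: essential_curve_def)
  have "h ` \<Delta> homeomorphic (cball 0 1 :: complex set)"
  proof -
    have "homeomorphism \<Delta> (h ` \<Delta>) h k"
      by (rule homeomorphism_of_subsets[OF hom]) auto
    then have "h ` \<Delta> homeomorphic \<Delta>"
      unfolding homeomorphic_def using homeomorphism_sym by blast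
    then show ?thesis using \<Delta>(2) by (rule homeomorphic_trans)
  qed
  moreover have "h ` \<Delta> \<inter> marked_points = h ` (\<Delta> \<inter> marked_points)"
  proof -
    have "h ` marked_points = marked_points" using fix_mp by auto
    then show ?thesis using image_Int[OF inj, of \<Delta> marked_points] by simp
  qed
  then have "card (h ` \<Delta> \<inter> marked_points) = 2"
    using \<Delta>(4) card_image[OF inj_on_subset[OF inj subset_UNIV]] by simp
  moreover have "h ` \<Delta> \<subseteq> disc" using \<Delta>(1) hd by blast
  moreover have "frontier (h ` \<Delta>) = h ` \<gamma>"
    using frontier_homeomorphism_UNIV[OF hom] \<Delta>(3) by simp
  moreover have "h ` \<gamma> \<subseteq> disc - marked_points"
    using sub marked_disc_homeo_image_Diff[OF h] by blast
  moreover have "simple_path (h \<circ> p)" "pathfinish (h \<circ> p) = pathstart (h \<circ> p)"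
    "path_image (h \<circ> p) = h ` \<gamma>"
    using p simple_path_homeomorphism_UNIV[OF hom]
    by (auto simp: pathfinish_compose pathstart_compose path_image_compose)
  ultimately show ?thesis unfolding essential_curve_def by blast
qed

lemma isotopic_curves_image:
  assumes h: "marked_disc_homeo h k" and "isotopic_curves \<gamma> \<delta>"
  shows "isotopic_curves (h ` \<gamma>) (h ` \<delta>)"
proof -
  have hom: "homeomorphism UNIV UNIV h k" using h by (simp add: marked_disc_homeo_def)
  obtain p q where pq: "homotopic_with_canon (\<lambda>r. simple_path r \<and> pathfinish r = pathstart r)
       {0..1} (disc - marked_points) p q" "path_image p = \<gamma>" "path_image q = \<delta>"
    using assms(2) by (auto simp: isotopic_curves_def)
  have "homotopic_with_canon (\<lambda>r. simple_path (h \<circ> r) \<and> pathfinish (h \<circ> r) = pathstart (h \<circ> r))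
       {0..1} (disc - marked_points) p q"
    by (rule homotopic_with_mono[OF pq(1)])
      (auto simp: simple_path_homeomorphism_UNIV[OF hom] pathfinish_compose pathstart_compose)
  then have "homotopic_with_canon (\<lambda>r. simple_path r \<and> pathfinish r = pathstart r)
       {0..1} (disc - marked_points) (h \<circ> p) (h \<circ> q)"
    using marked_disc_homeo_image_Diff[OF h] hom
    by (intro homotopic_with_compose_continuous_left)
      (auto simp: homeomorphism_def intro: continuous_on_subset)
  then show ?thesis
    unfolding isotopic_curves_def pq(2,3)[symmetric] path_image_compose[symmetric] by blast
qed

text \<open>The image of the class of \<gamma> is the class of the image curve: one inclusion
  carries curves and isotopies forward by \<open>h\<close>, the other carries them back by
  \<open>k\<close>.\<close>

lemma curve_classes_image:
  assumes h: "marked_disc_homeo h k" and "X \<in> curve_classes"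
  shows "(\<lambda>\<gamma>. h ` \<gamma>) ` X \<in> curve_classes"
proof -
  define cls where "cls \<gamma> = {\<delta>. essential_curve \<delta> \<and> isotopic_curves \<gamma> \<delta>}" for \<gamma>
  have classes: "curve_classes = cls ` {\<gamma>. essential_curve \<gamma>}"
    by (auto simp: curve_classes_def quotient_def cls_def)
  obtain \<gamma> where \<gamma>: "essential_curve \<gamma>" "X = cls \<gamma>" using assms(2) classes by blast
  note k = marked_disc_homeo_sym[OF h]
  have hk: "h ` k ` S = S" and kh: "k ` h ` S = S" for S
    using h by (auto simp: marked_disc_homeo_def homeomorphism_def image_image)
  have "(\<lambda>\<gamma>. h ` \<gamma>) ` X = cls (h ` \<gamma>)"
  proof (intro equalityI subsetI)
    fix \<delta> assume "\<delta> \<in> (\<lambda>\<gamma>. h ` \<gamma>) ` X"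
    then show "\<delta> \<in> cls (h ` \<gamma>)"
      using essential_curve_image[OF h] isotopic_curves_image[OF h] \<gamma> by (auto simp: cls_def)
  next
    fix \<delta> assume "\<delta> \<in> cls (h ` \<gamma>)"
    then have "k ` \<delta> \<in> X"
      using essential_curve_image[OF k, of \<delta>] isotopic_curves_image[OF k, of "h ` \<gamma>" \<delta>] \<gamma>(2)
      by (auto simp: cls_def kh)
    then show "\<delta> \<in> (\<lambda>\<gamma>. h ` \<gamma>) ` X" using hk[of \<delta>] by (intro image_eqI[of _ _ "k ` \<delta>"]) auto
  qed
  then show ?thesis using essential_curve_image[OF h \<gamma>(1)] classes by blast
qed


section \<open>The Dehn twists\<close>

text \<open>A rotation about \<open>q\<close> whose angle depends only on the distance to
  \<open>q\<close> preserves that distance, so rotating back by the same angle inverts it.\<close>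

lemma dehn_twist_homeomorphism: "\<exists>k. homeomorphism UNIV UNIV (dehn_twist q) k"
proof -
  define \<theta> where "\<theta> r = 2 * pi * max 0 (min 1 ((5 / 8 - r) / (1 / 4)))" for r :: real
  define k where "k z = q + cis (- \<theta> (cmod (z - q))) * (z - q)" for z
  have h: "dehn_twist q z = q + cis (\<theta> (cmod (z - q))) * (z - q)" for z
    by (simp add: dehn_twist_def \<theta>_def)
  have nh: "cmod (dehn_twist q z - q) = cmod (z - q)" for z
    by (simp add: h norm_mult)
  have nk: "cmod (k z - q) = cmod (z - q)" for z
    by (simp add: k_def norm_mult)
  have cis_cancel: "cis (- x) * (cis x * z) = z" "cis x * (cis (- x) * z) = z" for x z
    by (simp_all flip: mult.assoc add: cis_mult)
  have kh: "k (dehn_twist q z) = z" for z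
    unfolding k_def nh by (simp add: h cis_cancel)
  have hk: "dehn_twist q (k z) = z" for z
    unfolding h nk by (simp add: k_def cis_cancel)
  have "continuous_on UNIV (dehn_twist q)" "continuous_on UNIV k"
    unfolding h[abs_def] k_def[abs_def] \<theta>_def by (intro continuous_intros; simp)+
  then have "homeomorphism UNIV UNIV (dehn_twist q) k"
    using kh hk by (auto simp: homeomorphism_def image_iff) (metis kh hk)+
  then show ?thesis by blast
qed

lemma dehn_twist_fixes:
  assumes "cmod (z - q) \<le> 3 / 8 \<or> 5 / 8 \<le> cmod (z - q)"
  shows "dehn_twist q z = z"
proof -
  \<comment> \<open>The values 0 and 1 correspond to rotation by 0 and by a full turn, both the
    identity.\<close>
  have "max 0 (min 1 ((5 / 8 - cmod (z - q)) / (1 / 4))) \<in> {0, 1}"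
    using assms by (auto simp: max_def min_def)
  then show ?thesis by (auto simp: dehn_twist_def cis_2pi)
qed

text \<open>Since 5/8 + 1/4 < 1, the disc of radius 5/8 about \<open>q\<close> lies in
  \<open>disc\<close>; the twist maps it to itself and is the identity outside.\<close>

lemma dehn_twist_marked_disc_homeo:
  assumes "cmod q \<le> 1 / 4" and "\<forall>p\<in>marked_points. cmod (p - q) \<le> 3 / 8 \<or> 5 / 8 \<le> cmod (p - q)"
  shows "\<exists>k. marked_disc_homeo (dehn_twist q) k"
proof -
  obtain k where k: "homeomorphism UNIV UNIV (dehn_twist q) k"
    using dehn_twist_homeomorphism by blast
  have nh: "cmod (dehn_twist q z - q) = cmod (z - q)" for z
    by (simp add: dehn_twist_def norm_mult)
  have in_disc: "z \<in> disc" if "cmod (z - q) < 5 / 8" for z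
    using that assms(1) norm_triangle_ineq[of "z - q" q] by (simp add: disc_def)
  have iff: "dehn_twist q z \<in> disc \<longleftrightarrow> z \<in> disc" for z
  proof (cases "cmod (z - q) < 5 / 8")
    case True
    then show ?thesis using in_disc nh by simp
  next
    case False
    then show ?thesis using dehn_twist_fixes by simp
  qed
  have "dehn_twist q ` disc = disc"
  proof -
    have "z \<in> dehn_twist q ` disc" if "z \<in> disc" for z
      using that iff[of "k z"] k by (metis UNIV_I homeomorphism_apply2 image_eqI)
    then show ?thesis using iff by blast
  qed
  then show ?thesis
    using k assms(2) dehn_twist_fixes unfolding marked_disc_homeo_def by blast
qed

lemma twist_homeo_marked_disc_homeo: "\<exists>k. marked_disc_homeo (twist_homeo t) k"
proof -
  have c: "\<exists>k. marked_disc_homeo twist_homeo_c k"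
    unfolding twist_homeo_c_def
    by (rule dehn_twist_marked_disc_homeo)
      (auto simp: marked_points_def p1_def p2_def p3_def)
  have d: "\<exists>k. marked_disc_homeo twist_homeo_d k"
    unfolding twist_homeo_d_def
    by (rule dehn_twist_marked_disc_homeo)
      (auto simp: marked_points_def p1_def p2_def p3_def)
  have inv: "\<exists>k. marked_disc_homeo (inv h) k" if "\<exists>k. marked_disc_homeo h k" for h
    using that homeomorphism_UNIV_inv marked_disc_homeo_sym by (metis marked_disc_homeo_def)
  show ?thesis by (cases t) (use c d inv in auto)
qed

lemma apply_twist_curve_classes:
  "X \<in> curve_classes \<Longrightarrow> apply_twist t X \<in> curve_classes"
  using twist_homeo_marked_disc_homeo[of t] curve_classes_image unfolding apply_twist_def by blast

text \<open>With the inverse applied first, surjectivity of the twist suffices. This order lets the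
  formula for the twist be evaluated at the inverse image.\<close>

lemma apply_twist_inv_cancel:
  "apply_twist Tc (apply_twist Tc_inv X) = X" "apply_twist Td (apply_twist Td_inv X) = X"
proof -
  have "surj (twist_homeo t)" for t
    using twist_homeo_marked_disc_homeo[of t] by (auto simp: marked_disc_homeo_def homeomorphism_def)
  from this[of Tc] this[of Td] show
    "apply_twist Tc (apply_twist Tc_inv X) = X" "apply_twist Td (apply_twist Td_inv X) = X"
    by (simp_all add: apply_twist_def image_image surj_f_inv_f)
qed


section \<open>Untwisting in coordinates\<close>

text \<open>Each branch inverts the linear piece of \<open>dynnikov_tc\<close> in the same position,
  and its condition describes the image of that piece.\<close>

fun dynnikov_tc_inv :: "int \<times> int \<Rightarrow> int \<times> int" where
  "dynnikov_tc_inv (a, b) =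
     (if a \<le> 0 \<and> a + b \<le> 0 then (- a - b, - b)
      else if a \<ge> 0 \<and> b \<le> 0 then (a - b, 2 * a - b)
      else if b \<ge> 0 \<and> 2 * a + b \<ge> 0 then (a, b + 2 * a)
      else (- a - b, 2 * a + b))"

text \<open>Conjugate of \<open>dynnikov_tc_inv\<close> under \<open>v \<mapsto> - v\<close>, as
  \<open>dynnikov_td\<close> is of \<open>dynnikov_tc\<close>.\<close>

fun dynnikov_td_inv :: "int \<times> int \<Rightarrow> int \<times> int" where
  "dynnikov_td_inv (a, b) =
     (if a \<ge> 0 \<and> a + b \<ge> 0 then (- a - b, - b)
      else if a \<le> 0 \<and> b \<ge> 0 then (a - b, 2 * a - b)
      else if b \<le> 0 \<and> 2 * a + b \<le> 0 then (a, b + 2 * a)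
      else (- a - b, 2 * a + b))"

lemma dynnikov_tc_inv_tc: "dynnikov_tc_inv (dynnikov_tc v) = v"
  by (cases v) auto

lemma dynnikov_td_inv_td: "dynnikov_td_inv (dynnikov_td v) = v"
  by (cases v) auto

text \<open>At \<open>(1, 0)\<close> both twists allowed by the algorithm give
  \<open>(- 1, 0)\<close>, so a single function describes every run; the last branch yields this
  value.\<close>

fun untwist :: "int \<times> int \<Rightarrow> int \<times> int" where
  "untwist (a, b) =
     (if a > 0 \<and> b > 0 then dynnikov_tc (a, b)
      else if a < 0 \<and> b > 0 then dynnikov_tc_inv (a, b)
      else if a < 0 \<and> b < 0 then dynnikov_td (a, b)
      else dynnikov_td_inv (a, b))"

text \<open>Off the axes \<open>untwist\<close> decreases \<open>\<bar>a\<bar> + \<bar>b\<bar>\<close>; on the axes the recursion is cut off, since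
  \<open>untwist\<close> need not decrease it there (it takes \<open>(1, 0)\<close> to \<open>(- 1, 0)\<close>).\<close>

function untwist_steps :: "int \<times> int \<Rightarrow> nat" where
  "untwist_steps (a, b) =
     (if a = 0 \<or> b = 0 then (if (a, b) = (1, 0) then 1 else 0)
      else Suc (untwist_steps (untwist (a, b))))"
  by auto
termination
  \<comment> \<open>In every open quadrant the new sum is
    \<open>max \<bar>a\<bar> (\<bar>b\<bar> - \<bar>a\<bar>)\<close>.\<close>
  by (relation "Wellfounded.measure (\<lambda>(a, b). nat (\<bar>a\<bar> + \<bar>b\<bar>))") (auto split: if_splits)

declare untwist_steps.simps [simp del]

abbreviation Lambda_coords :: "(int \<times> int) set" where
  "Lambda_coords \<equiv> {(0, 1), (0, - 1), (- 1, 0)}"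

lemma primitive_vectors_axis:
  assumes "(a, b) \<in> primitive_vectors" and "a = 0 \<or> b = 0"
  shows "(a, b) \<in> insert (1, 0) Lambda_coords"
  using assms by (auto simp: primitive_vectors_def)

lemma untwist_steps_Lambda: "v \<in> Lambda_coords \<Longrightarrow> untwist_steps v = 0"
  by (auto simp: untwist_steps.simps)

lemma untwist_steps_untwist:
  assumes "v \<in> primitive_vectors" and "v \<notin> Lambda_coords"
  shows "untwist_steps v = Suc (untwist_steps (untwist v))"
proof (cases v)
  case (Pair a b)
  show ?thesis
  proof (cases "a = 0 \<or> b = 0")
    case True
    \<comment> \<open>The cut-off value 1 agrees with the recursion here, since
      \<open>untwist (1, 0) = (- 1, 0)\<close> has count 0.\<close>
    then have "v = (1, 0)" using assms primitive_vectors_axis[of a b] Pair by auto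
    then show ?thesis by (simp add: untwist_steps.simps)
  next
    case False
    then show ?thesis unfolding Pair by (subst untwist_steps.simps) auto
  qed
qed

lemma dynnikov_tc_untwist:
  assumes "v \<in> primitive_vectors" and "dynnikov_tc v \<noteq> v"
  shows "v \<notin> Lambda_coords \<and> untwist v = dynnikov_tc v \<or>
    dynnikov_tc v \<notin> Lambda_coords \<and> untwist (dynnikov_tc v) = v"
proof (cases v)
  case (Pair a b)
  show ?thesis
  proof (cases "a = 0 \<or> b = 0")
    case True
    then show ?thesis using assms primitive_vectors_axis[of a b] Pair by auto
  next
    case False
    then show ?thesis unfolding Pair by auto
  qed
qed

text \<open>Conjugation by \<open>v \<mapsto> - v\<close> swaps \<open>(1, 0)\<close> and
  \<open>(- 1, 0)\<close>, so the exceptional pair is now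
  \<open>dynnikov_td (- 1, 0) = (1, 0)\<close>, which falls under the second alternative.\<close>

lemma dynnikov_td_untwist:
  assumes "v \<in> primitive_vectors" and "dynnikov_td v \<noteq> v"
  shows "v \<notin> Lambda_coords \<and> untwist v = dynnikov_td v \<or>
    dynnikov_td v \<notin> Lambda_coords \<and> untwist (dynnikov_td v) = v"
proof (cases v)
  case (Pair a b)
  show ?thesis
  proof (cases "a = 0 \<or> b = 0")
    case True
    then show ?thesis using assms primitive_vectors_axis[of a b] Pair by auto
  next
    case False
    then show ?thesis unfolding Pair by auto
  qed
qed


section \<open>Algorithm and graph distance\<close>

lemma distance_to_Lambda_le:
  assumes "(X, Y) \<in> cayley_edges ^^ n" and "Y \<in> Lambda"
  shows "distance_to_Lambda X \<le> enat n"
  unfolding distance_to_Lambda_def graph_distance_def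
  using assms by (auto intro!: INF_lower2[of Y] INF_lower2[of n])

lemma distance_to_Lambda_ge:
  assumes "\<And>Y n. Y \<in> Lambda \<Longrightarrow> (X, Y) \<in> cayley_edges ^^ n \<Longrightarrow> m \<le> n"
  shows "enat m \<le> distance_to_Lambda X"
  unfolding distance_to_Lambda_def graph_distance_def
  using assms by (intro INF_greatest) auto

section \<open>Curve classes identified with their coordinates\<close>

context
  assumes dynnikov_bij: "bij_betw dynnikov curve_classes primitive_vectors"
    and tc_action: "\<And>X. X \<in> curve_classes \<Longrightarrow> dynnikov (apply_twist Tc X) = dynnikov_tc (dynnikov X)"
    and td_action: "\<And>X. X \<in> curve_classes \<Longrightarrow> dynnikov (apply_twist Td X) = dynnikov_td (dynnikov X)"
begin

lemma dynnikov_primitive: "X \<in> curve_classes \<Longrightarrow> dynnikov X \<in> primitive_vectors"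
  using dynnikov_bij bij_betwE by blast

lemma dynnikov_inj: "X \<in> curve_classes \<Longrightarrow> Y \<in> curve_classes \<Longrightarrow> dynnikov X = dynnikov Y \<longleftrightarrow> X = Y"
  using dynnikov_bij by (meson bij_betw_imp_inj_on inj_on_eq_iff)

text \<open>The formula for \<open>Tc\<close> at the curve \<open>apply_twist Tc_inv X\<close>,
  solved for the coordinates of that curve by the left inverse
  \<open>dynnikov_tc_inv\<close>.\<close>

lemma tc_inv_action:
  "X \<in> curve_classes \<Longrightarrow> dynnikov (apply_twist Tc_inv X) = dynnikov_tc_inv (dynnikov X)"
  using tc_action[of "apply_twist Tc_inv X"] apply_twist_curve_classes[of X Tc_inv]
  by (metis apply_twist_inv_cancel(1) dynnikov_tc_inv_tc)

lemma td_inv_action: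
  "X \<in> curve_classes \<Longrightarrow> dynnikov (apply_twist Td_inv X) = dynnikov_td_inv (dynnikov X)"
  using td_action[of "apply_twist Td_inv X"] apply_twist_curve_classes[of X Td_inv]
  by (metis apply_twist_inv_cancel(2) dynnikov_td_inv_td)

text \<open>Eliminates the definite descriptions that define c, d and e; the bijection provides
  existence and uniqueness.\<close>

lemma curve_with_coords:
  assumes "v \<in> primitive_vectors"
  shows "X = (THE X. X \<in> curve_classes \<and> dynnikov X = v) \<longleftrightarrow> X \<in> curve_classes \<and> dynnikov X = v"
proof -
  have "v \<in> dynnikov ` curve_classes"
    using assms bij_betw_imp_surj_on[OF dynnikov_bij] by simp
  then obtain Y where Y: "Y \<in> curve_classes" "dynnikov Y = v" by blast
  have "(THE X. X \<in> curve_classes \<and> dynnikov X = v) = Y"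
    using Y by (intro the_equality) (simp_all flip: dynnikov_inj)
  then show ?thesis using Y dynnikov_inj[of X Y] by auto
qed

lemma Lambda_iff: "X \<in> Lambda \<longleftrightarrow> X \<in> curve_classes \<and> dynnikov X \<in> Lambda_coords"
proof -
  have "(0, 1) \<in> primitive_vectors" "(0, - 1) \<in> primitive_vectors" "(- 1, 0) \<in> primitive_vectors"
    by (auto simp: primitive_vectors_def)
  note this [THEN curve_with_coords, of X]
  then show ?thesis
    unfolding Lambda_def curve_c_def curve_d_def curve_e_def insert_iff empty_iff by argo
qed

lemma untwist_steps_Suc:
  assumes "X \<in> curve_classes" and "X \<notin> Lambda"
  shows "untwist_steps (dynnikov X) = Suc (untwist_steps (untwist (dynnikov X)))"
  using untwist_steps_untwist[OF dynnikov_primitive[OF assms(1)]] assms by (simp add: Lambda_iff)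

lemma untwist_steps_eq_0_iff:
  assumes "X \<in> curve_classes"
  shows "untwist_steps (dynnikov X) = 0 \<longleftrightarrow> X \<in> Lambda"
  using untwist_steps_Suc[OF assms] untwist_steps_Lambda[of "dynnikov X"] Lambda_iff[of X] by auto

lemma dynnikov_quadrant:
  assumes "X \<in> curve_classes" and "X \<notin> Lambda"
  obtains a b where "dynnikov X = (a, b)" "a > 0" "b > 0"
  | a b where "dynnikov X = (a, b)" "a < 0" "b > 0"
  | a b where "dynnikov X = (a, b)" "a < 0" "b < 0"
  | a b where "dynnikov X = (a, b)" "a > 0" "b < 0"
  | "dynnikov X = (1, 0)"
proof -
  obtain a b where ab: "dynnikov X = (a, b)" by fastforce
  have "(a, b) = (1, 0)" if "a = 0 \<or> b = 0"
    using primitive_vectors_axis[OF _ that] dynnikov_primitive[OF assms(1)] assms ab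
    by (auto simp: Lambda_iff)
  then show thesis using ab that by (metis linorder_less_linear)
qed

section \<open>Runs of the algorithm\<close>

lemma untwisting_choice_exists:
  assumes "X \<in> curve_classes" and "X \<notin> Lambda"
    and "dynnikov X = (1, 0) \<Longrightarrow> prev \<in> {None, Some Tc, Some Td_inv}"
  shows "\<exists>t. untwisting_choice prev X t"
  using assms(1,2) by (cases rule: dynnikov_quadrant) (use assms(3) in \<open>auto simp: untwisting_choice_def\<close>)

text \<open>The second conjunct is the invariant that keeps a run from getting stuck. It holds
  because \<open>Tc_inv\<close> and \<open>Td\<close> lead to \<open>(1, 0)\<close> only from
  \<open>(- 1, 0)\<close>, where the algorithm has already stopped.\<close>

lemma untwisting_choice_untwist:
  assumes "X \<in> curve_classes" and "X \<notin> Lambda" and "untwisting_choice prev X t"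
  shows "dynnikov (apply_twist t X) = untwist (dynnikov X) \<and>
    (dynnikov (apply_twist t X) = (1, 0) \<longrightarrow> t \<in> {Tc, Td_inv})"
  using assms(1,2)
proof (cases rule: dynnikov_quadrant)
  case (1 a b)
  then have "t = Tc" using assms(3) by (simp add: untwisting_choice_def)
  then show ?thesis using 1 tc_action[OF assms(1)] by simp
next
  case (2 a b)
  then have "t = Tc_inv" using assms(3) by (simp add: untwisting_choice_def)
  moreover have "dynnikov_tc_inv (a, b) \<noteq> (1, 0)" using 2 by auto
  ultimately show ?thesis using 2 tc_inv_action[OF assms(1)] by simp
next
  case (3 a b)
  then have "t = Td" using assms(3) by (simp add: untwisting_choice_def)
  moreover have "dynnikov_td (a, b) \<noteq> (1, 0)" using 3 by auto
  ultimately show ?thesis using 3 td_action[OF assms(1)] by simp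
next
  case (4 a b)
  then have "t = Td_inv" using assms(3) by (simp add: untwisting_choice_def)
  then show ?thesis using 4 td_inv_action[OF assms(1)] by simp
next
  case 5
  then have "t = Tc \<or> t = Td_inv" using assms(3) by (auto simp: untwisting_choice_def)
  then show ?thesis using 5 tc_action[OF assms(1)] td_inv_action[OF assms(1)] by auto
qed

text \<open>
  The algorithm can only get stuck at \<open>(1, 0)\<close>, after a twist other than those allowed there.
\<close>

lemma untwisting_takes_untwist_steps:
  assumes "X \<in> curve_classes"
    and "dynnikov X = (1, 0) \<Longrightarrow> prev \<in> {None, Some Tc, Some Td_inv}"
  shows "untwisting_takes prev X (untwist_steps (dynnikov X))"
  using assms
proof (induction "untwist_steps (dynnikov X)" arbitrary: X prev)
  case 0
  then have "X \<in> Lambda" using untwist_steps_eq_0_iff by simp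
  then show ?case using untwisting_takes.stop 0(1) by simp
next
  case (Suc n)
  have notin: "X \<notin> Lambda"
    using Suc.hyps(2) untwist_steps_eq_0_iff[OF Suc.prems(1)] by auto
  have "untwisting_takes (Some t) (apply_twist t X) n" if t: "untwisting_choice prev X t" for t
  proof -
    note choice = untwisting_choice_untwist[OF Suc.prems(1) notin t]
    have n: "n = untwist_steps (dynnikov (apply_twist t X))"
      using Suc.hyps(2) untwist_steps_Suc[OF Suc.prems(1) notin] choice by simp
    have "Some t \<in> {None, Some Tc, Some Td_inv}" if "dynnikov (apply_twist t X) = (1, 0)"
      using choice that by simp
    from Suc.hyps(1)[OF n apply_twist_curve_classes[OF Suc.prems(1)] this] n
    show ?thesis by simp
  qed
  from untwisting_takes.step[OF notin untwisting_choice_exists[OF Suc.prems(1) notin Suc.prems(2)] this]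
  show ?case using Suc.hyps(2) by simp
qed

section \<open>Lower bound: the step count along edges and paths\<close>

lemma cayley_edge_untwist:
  assumes "(X, Y) \<in> cayley_edges"
  shows "X \<notin> Lambda \<and> untwist (dynnikov X) = dynnikov Y \<or>
    Y \<notin> Lambda \<and> untwist (dynnikov Y) = dynnikov X"
proof -
  \<comment> \<open>The claim is symmetric in the two endpoints, so it suffices to treat pairs
    consisting of a curve and its image under a generator.\<close>
  have twist: "X \<notin> Lambda \<and> untwist (dynnikov X) = dynnikov (apply_twist g X) \<or>
      apply_twist g X \<notin> Lambda \<and> untwist (dynnikov (apply_twist g X)) = dynnikov X"
    if X: "X \<in> curve_classes" and ne: "apply_twist g X \<noteq> X" and g: "g \<in> {Tc, Td}" for X g
  proof -
    note gX = apply_twist_curve_classes[OF X, of g]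
    have "dynnikov (apply_twist g X) \<noteq> dynnikov X" using ne dynnikov_inj[OF gX X] by simp
    then show ?thesis
      using g dynnikov_tc_untwist[OF dynnikov_primitive[OF X]]
        dynnikov_td_untwist[OF dynnikov_primitive[OF X]]
      \<comment> \<open>\<open>insert_iff\<close> is restricted to the membership of
        \<open>g\<close>, so that \<open>Lambda_coords\<close> stays intact and matches the
        coordinate lemmas.\<close>
      by (auto simp del: insert_iff simp: insert_iff[of g] Lambda_iff X tc_action[OF X] td_action[OF X])
  qed
  obtain g where "X \<in> curve_classes" "Y \<in> curve_classes" "X \<noteq> Y" "g \<in> {Tc, Td}"
    and "Y = apply_twist g X \<or> X = apply_twist g Y"
    using assms by (auto simp: cayley_edges_def)
  then show ?thesis using twist[of X g] twist[of Y g] by metis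
qed

lemma cayley_edge_untwist_steps:
  assumes "(X, Y) \<in> cayley_edges"
  shows "untwist_steps (dynnikov X) \<le> Suc (untwist_steps (dynnikov Y))"
proof -
  have X: "X \<in> curve_classes" and Y: "Y \<in> curve_classes"
    using assms by (auto simp: cayley_edges_def)
  from cayley_edge_untwist[OF assms] show ?thesis
  proof (elim disjE conjE)
    assume "X \<notin> Lambda" "untwist (dynnikov X) = dynnikov Y"
    then show ?thesis using untwist_steps_Suc[OF X] by simp
  next
    assume "Y \<notin> Lambda" "untwist (dynnikov Y) = dynnikov X"
    then show ?thesis using untwist_steps_Suc[OF Y] by simp
  qed
qed

lemma cayley_path_untwist_steps:
  "(X, Y) \<in> cayley_edges ^^ n \<Longrightarrow> untwist_steps (dynnikov X) \<le> n + untwist_steps (dynnikov Y)"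
proof (induction n arbitrary: Y)
  case (Suc n)
  then obtain Z where "(X, Z) \<in> cayley_edges ^^ n" "(Z, Y) \<in> cayley_edges" by auto
  then show ?case using Suc.IH[of Z] cayley_edge_untwist_steps[of Z Y] by simp
qed simp

section \<open>Upper bound: a run of the algorithm as a path\<close>

lemma untwist_cayley_edge:
  assumes X: "X \<in> curve_classes" and notin: "X \<notin> Lambda"
  shows "\<exists>Y. (X, Y) \<in> cayley_edges \<and> dynnikov Y = untwist (dynnikov X)"
proof -
  obtain t where t: "untwisting_choice None X t"
    using untwisting_choice_exists[OF assms] by blast
  let ?Y = "apply_twist t X"
  have Y: "dynnikov ?Y = untwist (dynnikov X)" using untwisting_choice_untwist[OF assms t] by blast
  \<comment> \<open>A loop would make the step count its own successor.\<close>
  then have "X \<noteq> ?Y" using untwist_steps_Suc[OF assms] by auto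
  \<comment> \<open>An inverse twist traverses the edge of its generator backwards.\<close>
  moreover have "\<exists>g\<in>{Tc, Td}. ?Y = apply_twist g X \<or> X = apply_twist g ?Y"
    by (cases t) (auto simp: apply_twist_inv_cancel)
  ultimately have "(X, ?Y) \<in> cayley_edges"
    using apply_twist_curve_classes[OF X] X unfolding cayley_edges_def by blast
  then show ?thesis using Y by blast
qed

lemma untwist_cayley_path:
  assumes "X \<in> curve_classes"
  shows "\<exists>Y\<in>Lambda. (X, Y) \<in> cayley_edges ^^ untwist_steps (dynnikov X)"
  using assms
proof (induction "untwist_steps (dynnikov X)" arbitrary: X)
  case 0
  then have "X \<in> Lambda" using untwist_steps_eq_0_iff by simp
  then show ?case using 0(1) by (auto intro: bexI[of _ X])
next
  case (Suc n)
  have notin: "X \<notin> Lambda"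
    using Suc.hyps(2) untwist_steps_eq_0_iff[OF Suc.prems] by auto
  obtain Y where Y: "(X, Y) \<in> cayley_edges" "dynnikov Y = untwist (dynnikov X)"
    using untwist_cayley_edge[OF Suc.prems notin] by blast
  have "Y \<in> curve_classes" using Y(1) by (simp add: cayley_edges_def)
  moreover have "n = untwist_steps (dynnikov Y)"
    using Suc.hyps(2) untwist_steps_Suc[OF Suc.prems notin] Y(2) by simp
  ultimately obtain Z where "Z \<in> Lambda" "(Y, Z) \<in> cayley_edges ^^ n"
    using Suc.hyps(1) by blast
  then show ?case using Y(1) unfolding Suc.hyps(2)[symmetric] by (blast intro: relpow_Suc_I2)
qed

lemma distance_to_Lambda_untwist_steps:
  assumes "X \<in> curve_classes"
  shows "distance_to_Lambda X = enat (untwist_steps (dynnikov X))"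
proof (rule antisym)
  show "distance_to_Lambda X \<le> enat (untwist_steps (dynnikov X))"
    using untwist_cayley_path[OF assms] distance_to_Lambda_le by blast
  show "enat (untwist_steps (dynnikov X)) \<le> distance_to_Lambda X"
    \<comment> \<open>The count vanishes at the end of a path in \<open>Lambda\<close>, so the
      length of the path bounds the count at its start.\<close>
    using cayley_path_untwist_steps untwist_steps_Lambda Lambda_iff
    by (intro distance_to_Lambda_ge) (metis add_0_right)
qed

end

theorem theorem5p2:
  fixes \<gamma> :: curve_class
  assumes dynnikov_bij: "bij_betw dynnikov curve_classes primitive_vectors"
    and tc_action: "\<And>X. X \<in> curve_classes \<Longrightarrow> dynnikov (apply_twist Tc X) = dynnikov_tc (dynnikov X)"
    and td_action: "\<And>X. X \<in> curve_classes \<Longrightarrow> dynnikov (apply_twist Td X) = dynnikov_td (dynnikov X)"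
    and "\<gamma> \<in> curve_classes"
  shows "\<exists>n. untwisting_takes None \<gamma> n \<and> distance_to_Lambda \<gamma> = enat n"
  \<comment> \<open>The common value is \<open>untwist_steps (dynnikov \<gamma>)\<close>; the
    condition at \<open>(1, 0)\<close> holds because a run starts with
    \<open>prev = None\<close>.\<close>
  using untwisting_takes_untwist_steps[OF assms(1-4)] distance_to_Lambda_untwist_steps[OF assms(1-4)]
  by blast

end
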